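(* Let $N, C\in\mathbb{N}_+$, let $P\in\mathbb{R}^{N\times N}$ be a symmetric matrix, and let $U\subset\mathbb{R}^N$ be an $M$-dimensional subspace ($M\le N$) such that (1) $U$ has an orthonormal basis $(e_m)_{m\in[M]}$ consisting of non-negative vectors, and (2) $U$ is invariant under $P$ (if $u\in U$ then $Pu\in U$). Let $\lambda$ be the operator norm of $P|_{U^\perp}:U^\perp\to U^\perp$. For each $l\in\mathbb{N}_+$ let $H_l\in\mathbb{N}_+$, let $W_{lh}\in\mathbb{R}^{C\times C}$ for $h\in[H_l]$, let $s_{lh}$ be the maximum singular value of $W_{lh}$, let $s_l:=\prod_{h=1}^{H_l}s_{lh}$, and let $f_l(X):=\mathrm{MLP}_l(PX)$ for $X\in\mathbb{R}^{N\times C}$. Let $\mathcal{M}:=U\otimes\mathbb{R}^C$. Then for every $l\in\mathbb{N}_+$ and every $X\in\mathbb{R}^{N\times C}$, $$d_{\mathcal{M}}(f_l(X))\le s_l\,\lambda\, d_{\mathcal{M}}(X).$$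
   Context: Notation: $[N]=\{1,\dots,N\}$. A vector is non-negative if all its entries are $\ge 0$. $\sigma$ is the element-wise ReLU, $\sigma(X)_{nc}=\max(X_{nc},0)$. The map $\mathrm{MLP}_l:\mathbb{R}^{N\times C}\to\mathbb{R}^{N\times C}$ is $\mathrm{MLP}_l(X):=\sigma(\cdots\sigma(\sigma(X)W_{l1})W_{l2}\cdots W_{lH_l})$, i.e. $\mathrm{MLP}_l(X)=Z_{H_l}$ where $Z_0=\sigma(X)$ and $Z_h=\sigma(Z_{h-1}W_{lh})$ for $h=1,\dots,H_l$. $U^\perp$ is the orthogonal complement of $U$ for the standard inner product of $\mathbb{R}^N$; since $P$ is symmetric and $U$ is $P$-invariant, $U^\perp$ is also $P$-invariant, so $P|_{U^\perp}:U^\perp\to U^\perp$ makes sense. For $v\in\mathbb{R}^N$, $w\in\mathbb{R}^C$, $v\otimes w\in\mathbb{R}^{N\times C}$ is $(v\otimes w)_{nc}=v_nw_c$, and $U\otimes\mathbb{R}^C=\{\sum_{m=1}^M e_m\otimes w_m\mid w_m\in\mathbb{R}^C\}$. $d_{\mathcal{M}}(X):=\inf\{\|X-Y\|_{\mathrm F}\mid Y\in\mathcal{M}\}$ with $\|\cdot\|_{\mathrm F}$ the Frobenius norm. *)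

theory Defs
  imports "HOL-Analysis.Analysis"
begin

text \<open>
  A matrix with rows indexed by \<open>'n\<close> and columns by \<open>'c\<close> has type \<open>real ^ 'c ^ 'n\<close>. On this type the
  library norm is the Frobenius norm, so \<^const>\<open>infdist\<close> is the Frobenius distance to a set.
\<close>

lemma norm_matrix_Frobenius:
  fixes X :: "real ^ 'c ^ 'n"
  shows "norm X = sqrt (\<Sum>n\<in>UNIV. \<Sum>c\<in>UNIV. (X $ n $ c)\<^sup>2)"
  by (simp add: norm_vec_def L2_set_def sum_nonneg)

lemma infdist_matrix:
  fixes X :: "real ^ 'c ^ 'n"
  assumes "S \<noteq> {}"
  shows "infdist X S = Inf {norm (X - Y) | Y. Y \<in> S}"
  using assms by (simp add: infdist_def dist_norm image_def Bex_def conj_commute Setcompr_eq_image)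

definition relu :: "real ^ 'c ^ 'n \<Rightarrow> real ^ 'c ^ 'n" where
  "relu X = (\<chi> n c. max (X $ n $ c) 0)"

text \<open>\<open>mlp W h X\<close> is \<open>Z\<^sub>h\<close>; note the activation applied to the input. The weights are \<open>W 1, W 2, \<dots>\<close>.\<close>

primrec mlp :: "(nat \<Rightarrow> real ^ 'c ^ 'c) \<Rightarrow> nat \<Rightarrow> real ^ 'c ^ 'n \<Rightarrow> real ^ 'c ^ 'n" where
  "mlp W 0 X = relu X"
| "mlp W (Suc h) X = relu (mlp W h X ** W (Suc h))"

definition gnn_layer ::
    "real ^ 'n ^ 'n \<Rightarrow> (nat \<Rightarrow> real ^ 'c ^ 'c) \<Rightarrow> nat \<Rightarrow> real ^ 'c ^ 'n \<Rightarrow> real ^ 'c ^ 'n" where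
  "gnn_layer P W H X = mlp W H (P ** X)"

definition eigenvalues :: "real ^ 'n ^ 'n \<Rightarrow> real set" where
  "eigenvalues A = {\<mu>. \<exists>v. v \<noteq> 0 \<and> A *v v = \<mu> *\<^sub>R v}"

definition singular_values :: "real ^ 'n ^ 'm \<Rightarrow> real set" where
  "singular_values A = sqrt ` eigenvalues (transpose A ** A)"

definition max_singular_value :: "real ^ 'n ^ 'm \<Rightarrow> real" where
  "max_singular_value A = Max (singular_values A)"

text \<open>
  The operator norm of the restriction of \<open>f\<close> to a subspace \<open>S\<close>, relativising \<^const>\<open>onorm\<close>. As there,
  the quotient at \<open>0\<close> is \<open>0\<close>, and the value is \<open>0\<close> for the trivial subspace.
\<close>

definition onorm_on ::
    "'a set \<Rightarrow> ('a::real_normed_vector \<Rightarrow> 'b::real_normed_vector) \<Rightarrow> real" where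
  "onorm_on S f = (SUP x\<in>S. norm (f x) / norm x)"

definition orthonormal_basis :: "nat \<Rightarrow> (nat \<Rightarrow> 'a::euclidean_space) \<Rightarrow> 'a set \<Rightarrow> bool" where
  "orthonormal_basis M e U \<longleftrightarrow>
     (\<forall>i\<in>{1..M}. \<forall>j\<in>{1..M}. e i \<bullet> e j = (if i = j then 1 else 0)) \<and> span (e ` {1..M}) = U"

definition tensor :: "real ^ 'n \<Rightarrow> real ^ 'c \<Rightarrow> real ^ 'c ^ 'n" where
  "tensor v w = (\<chi> n c. v $ n * w $ c)"

text \<open>\<open>U \<otimes> \<real>\<^sup>C\<close>, where \<open>e 1, \<dots>, e M\<close> is a basis of \<open>U\<close>.\<close>

definition tensor_space :: "nat \<Rightarrow> (nat \<Rightarrow> real ^ 'n) \<Rightarrow> (real ^ 'c ^ 'n) set" where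
  "tensor_space M e = {(\<Sum>m=1..M. tensor (e m) (w m)) | w. True}"

end

theory Submission
  imports Defs
begin

text \<open>
  Let \<open>A\<close> be the matrix of the orthogonal projection onto \<open>U\<^sup>\<bottom>\<close>, so that the distance of \<open>X\<close> to
  \<open>U \<otimes> \<real>\<^sup>C\<close> is the Frobenius norm of \<open>A X\<close>. Since \<open>A\<close> commutes with \<open>P\<close> and
  \<open>A (X W) = (A X) W\<close>, multiplication by \<open>P\<close> scales the distance by at most \<open>\<lambda>\<close> and multiplication
  by \<open>W\<close> by at most its largest singular value. For ReLU, write a column as \<open>x = x\<^sup>+ - x\<^sup>-\<close>: since
  \<open>\<langle>e\<^sub>m, x\<^sup>+\<rangle>\<close> and \<open>\<langle>e\<^sub>m, x\<^sup>-\<rangle>\<close> are non-negative, \<open>\<langle>e\<^sub>m, x\<rangle>\<^sup>2 - \<langle>e\<^sub>m, x\<^sup>+\<rangle>\<^sup>2 \<le> \<langle>e\<^sub>m, x\<^sup>-\<rangle>\<^sup>2\<close>, and Bessel's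
  inequality for \<open>x\<^sup>-\<close> shows that passing to \<open>x\<^sup>+\<close> does not increase the distance to \<open>U\<close>.
\<close>

section \<open>Eigenvalues of a symmetric real matrix\<close>

lemma symmetric_matrix_inner:
  fixes A :: "real ^ 'n ^ 'n"
  assumes "transpose A = A"
  shows "x \<bullet> (A *v y) = (A *v x) \<bullet> y"
  using dot_lmul_matrix[of x A y] transpose_matrix_vector[of A x] assms by simp

text \<open>Eigenvectors for distinct eigenvalues are orthogonal, and a pairwise orthogonal set in
  finite dimension is finite. This makes the \<open>Max\<close> in \<open>max_singular_value\<close>
  a genuine maximum.\<close>

lemma finite_eigenvalues_symmetric:
  fixes A :: "real ^ 'n ^ 'n"
  assumes "transpose A = A"
  shows "finite (eigenvalues A)"
proof -
  define v where "v \<mu> = (SOME v. v \<noteq> 0 \<and> A *v v = \<mu> *\<^sub>R v)" for \<mu>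
  have v: "v \<mu> \<noteq> 0 \<and> A *v v \<mu> = \<mu> *\<^sub>R v \<mu>" if "\<mu> \<in> eigenvalues A" for \<mu>
    using that unfolding v_def eigenvalues_def mem_Collect_eq by (rule someI_ex)
  have orth: "v \<mu> \<bullet> v \<nu> = 0" if "\<mu> \<in> eigenvalues A" "\<nu> \<in> eigenvalues A" "\<mu> \<noteq> \<nu>" for \<mu> \<nu>
  proof -
    have "\<nu> * (v \<mu> \<bullet> v \<nu>) = \<mu> * (v \<mu> \<bullet> v \<nu>)"
      using symmetric_matrix_inner[OF assms, of "v \<mu>" "v \<nu>"] v[OF that(1)] v[OF that(2)]
      by simp
    with that(3) show ?thesis by simp
  qed
  have "pairwise orthogonal (v ` eigenvalues A)"
    by (auto simp: pairwise_def orthogonal_def intro: orth)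
  moreover have "inj_on v (eigenvalues A)"
  proof (rule inj_onI, rule ccontr)
    fix \<mu> \<nu> assume "\<mu> \<in> eigenvalues A" "\<nu> \<in> eigenvalues A" "v \<mu> = v \<nu>" "\<mu> \<noteq> \<nu>"
    then show False using orth[of \<mu> \<nu>] v[of \<nu>] by simp
  qed
  ultimately show ?thesis
    using finite_imageD pairwise_orthogonal_imp_finite by blast
qed

text \<open>The maximum of the Rayleigh quotient is attained, at an eigenvector.\<close>

lemma symmetric_matrix_eigenvalue_bound:
  fixes A :: "real ^ 'n ^ 'n"
  assumes sym: "transpose A = A"
  obtains \<mu> where "\<mu> \<in> eigenvalues A" "\<And>x. x \<bullet> (A *v x) \<le> \<mu> * (x \<bullet> x)"
proof -
  have "continuous_on (sphere 0 1) (\<lambda>x. x \<bullet> (A *v x))"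
    by (intro continuous_intros linear_continuous_on matrix_vector_mul_bounded_linear)
  moreover have "sphere (0 :: real ^ 'n) 1 \<noteq> {}" by simp
  ultimately obtain v where v: "v \<in> sphere 0 1"
    and max: "\<And>y. y \<in> sphere 0 1 \<Longrightarrow> y \<bullet> (A *v y) \<le> v \<bullet> (A *v v)"
    using continuous_attains_sup[of "sphere 0 1" "\<lambda>x. x \<bullet> (A *v x)"] by auto
  define \<mu> where "\<mu> = v \<bullet> (A *v v)"
  have bound: "x \<bullet> (A *v x) \<le> \<mu> * (x \<bullet> x)" for x
  proof (cases "x = 0")
    case False
    have "sgn x \<bullet> (A *v sgn x) \<le> \<mu>"
      unfolding \<mu>_def using False by (intro max) (simp add: norm_sgn)
    then have "(x \<bullet> (A *v x)) / (norm x)\<^sup>2 \<le> \<mu>"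
      by (simp add: sgn_div_norm matrix_vector_mult_scaleR power2_eq_square divide_inverse mult_ac)
    with False show ?thesis
      by (simp add: divide_le_eq power2_norm_eq_inner)
  qed auto
  have vv: "v \<bullet> v = 1" using v by (simp add: dot_square_norm)
  \<comment> \<open>The form \<open>q\<close> is non-negative by \<open>bound\<close> and vanishes
    at \<open>v\<close>, where its gradient is \<open>2 *\<^sub>R b\<close>. A small move from
    \<open>v\<close> along \<open>- b\<close> would make \<open>q\<close> negative unless
    \<open>b = 0\<close>, which says that \<open>v\<close> is an eigenvector.\<close>
  define q where "q x = \<mu> * (x \<bullet> x) - x \<bullet> (A *v x)" for x
  define b where "b = \<mu> *\<^sub>R v - A *v v"
  have expand: "q (v - t *\<^sub>R b) = t\<^sup>2 * q b - 2 * t * (b \<bullet> b)" for t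
  proof -
    have "v \<bullet> (A *v b) = b \<bullet> (A *v v)"
      using symmetric_matrix_inner[OF sym, of v b] by (simp add: inner_commute)
    then have "q (v - t *\<^sub>R b) = t\<^sup>2 * q b - 2 * t * (\<mu> * (b \<bullet> v) - b \<bullet> (A *v v))"
      using vv by (simp add: q_def matrix_vector_mult_diff_distrib matrix_vector_mult_scaleR
          inner_diff inner_commute[of v b] \<mu>_def[symmetric] power2_eq_square algebra_simps)
    also have "\<mu> * (b \<bullet> v) - b \<bullet> (A *v v) = b \<bullet> b"
      by (subst (4) b_def) (simp add: inner_diff_right)
    finally show ?thesis .
  qed
  have "b \<bullet> b = 0"
  proof (rule ccontr)
    assume "b \<bullet> b \<noteq> 0"
    then have n: "b \<bullet> b > 0" by (simp add: order_less_le)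
    have qb: "q b \<ge> 0" using bound[of b] by (simp add: q_def)
    \<comment> \<open>Small enough for the linear term to beat the quadratic one; the
      \<open>+ 1\<close> keeps the denominator positive when \<open>q b = 0\<close>.\<close>
    define t where "t = (b \<bullet> b) / (q b + 1)"
    have t: "t > 0" "t * q b < b \<bullet> b"
      using n qb by (simp_all add: t_def divide_less_eq)
    have "0 \<le> q (v - t *\<^sub>R b)" using bound by (simp add: q_def)
    also have "\<dots> = t * (t * q b - 2 * (b \<bullet> b))"
      by (simp add: expand power2_eq_square algebra_simps)
    also have "\<dots> < 0" using t n by (intro mult_pos_neg) linarith+
    finally show False by simp
  qed
  then have "A *v v = \<mu> *\<^sub>R v" by (simp add: b_def)
  moreover have "v \<noteq> 0" using vv by auto
  ultimately have "\<mu> \<in> eigenvalues A" by (auto simp: eigenvalues_def)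
  with bound show thesis using that by blast
qed

section \<open>The largest singular value as a norm bound\<close>

lemma norm_mult_max_singular_value:
  fixes W :: "real ^ 'n ^ 'm"
  shows "norm (W *v x) \<le> max_singular_value W * norm x"
proof -
  let ?A = "transpose W ** W"
  have sym: "transpose ?A = ?A" by (simp add: matrix_transpose_mul)
  obtain \<mu> where \<mu>: "\<mu> \<in> eigenvalues ?A" "\<And>x. x \<bullet> (?A *v x) \<le> \<mu> * (x \<bullet> x)"
    using symmetric_matrix_eigenvalue_bound[OF sym] by blast
  have "(norm (W *v x))\<^sup>2 = x \<bullet> (?A *v x)"
    by (metis dot_lmul_matrix matrix_vector_mul_assoc power2_norm_eq_inner transpose_matrix_vector
        transpose_transpose)
  also have "\<dots> \<le> \<mu> * (norm x)\<^sup>2"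
    using \<mu>(2) by (simp add: power2_norm_eq_inner)
  finally have "norm (W *v x) \<le> sqrt \<mu> * norm x"
    by (metis norm_ge_zero real_le_rsqrt real_sqrt_mult real_sqrt_abs abs_of_nonneg)
  moreover have "sqrt \<mu> \<le> max_singular_value W"
    unfolding max_singular_value_def singular_values_def
    using \<mu>(1) finite_eigenvalues_symmetric[OF sym] by (intro Max_ge) auto
  ultimately show ?thesis
    by (meson mult_right_mono norm_ge_zero order_trans)
qed

lemma max_singular_value_nonneg: "0 \<le> max_singular_value W"
  using norm_mult_max_singular_value[of W "axis undefined 1"]
  by (metis (no_types) norm_axis_1 mult.right_neutral norm_ge_zero order_trans)

text \<open>Duality: for \<open>z = transpose W *v y\<close>, the square of \<open>norm z\<close> is
  \<open>y \<bullet> (W *v z)\<close>; Cauchy-Schwarz and the bound for \<open>W\<close> leave one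
  factor \<open>norm z\<close> to cancel. No comparison of the spectra of \<open>W\<close> and its
  transpose is involved.\<close>

lemma norm_transpose_mult_max_singular_value:
  fixes W :: "real ^ 'n ^ 'm"
  shows "norm (transpose W *v y) \<le> max_singular_value W * norm y"
proof (cases "transpose W *v y = 0")
  case True
  then show ?thesis by (simp add: max_singular_value_nonneg)
next
  case False
  let ?z = "transpose W *v y"
  have "norm ?z * norm ?z = y \<bullet> (W *v ?z)"
    by (metis dot_lmul_matrix norm_eq_sqrt_inner inner_ge_zero real_sqrt_mult_self abs_of_nonneg
        transpose_matrix_vector)
  also have "\<dots> \<le> norm y * norm (W *v ?z)" by (rule norm_cauchy_schwarz)
  also have "\<dots> \<le> norm y * (max_singular_value W * norm ?z)"
    by (intro mult_left_mono norm_mult_max_singular_value) simp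
  finally show ?thesis using False by (simp add: mult_ac)
qed

section \<open>Frobenius norm by rows and by columns\<close>

lemma norm_matrix_rows:
  fixes X :: "real ^ 'c ^ 'n"
  shows "(norm X)\<^sup>2 = (\<Sum>i\<in>UNIV. (norm (X $ i))\<^sup>2)"
  by (simp add: norm_vec_def[of X] L2_set_def sum_nonneg)

lemma norm_matrix_columns:
  fixes X :: "real ^ 'c ^ 'n"
  shows "(norm X)\<^sup>2 = (\<Sum>c\<in>UNIV. (norm (column c X))\<^sup>2)"
  unfolding power2_norm_eq_inner inner_vec_def
  by (subst sum.swap) (simp add: column_def)

lemma column_matrix_mult: "column c (A ** X) = A *v column c X"
  by (simp add: vec_eq_iff column_def matrix_matrix_mult_def matrix_vector_mult_def)

text \<open>Squared Frobenius norms add up over columns. This reduces left multiplication and ReLU,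
  which act column by column, to statements about vectors.\<close>

lemma norm_le_by_columns:
  fixes X :: "real ^ 'c ^ 'n" and Y :: "real ^ 'c ^ 'm"
  assumes "\<And>c. norm (column c X) \<le> k * norm (column c Y)" and "0 \<le> k"
  shows "norm X \<le> k * norm Y"
proof (rule power2_le_imp_le)
  show "(norm X)\<^sup>2 \<le> (k * norm Y)\<^sup>2"
    unfolding power_mult_distrib norm_matrix_columns[of X] norm_matrix_columns[of Y] sum_distrib_left
    by (intro sum_mono) (metis assms(1) power_mono norm_ge_zero power_mult_distrib)
qed (simp add: assms)

text \<open>Right multiplication by \<open>W\<close> applies \<open>transpose W\<close> to each row,
  so the transposed bound is summed over rows.\<close>

lemma norm_mult_right_max_singular_value:
  fixes Y :: "real ^ 'c ^ 'n" and W :: "real ^ 'd ^ 'c"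
  shows "norm (Y ** W) \<le> max_singular_value W * norm Y"
proof (rule power2_le_imp_le)
  have "(Y ** W) $ i = transpose W *v (Y $ i)" for i
    by (simp add: vec_eq_iff matrix_matrix_mult_def matrix_vector_mult_def transpose_def mult.commute)
  then have "norm ((Y ** W) $ i) \<le> max_singular_value W * norm (Y $ i)" for i
    by (simp only: norm_transpose_mult_max_singular_value)
  then show "(norm (Y ** W))\<^sup>2 \<le> (max_singular_value W * norm Y)\<^sup>2"
    unfolding power_mult_distrib norm_matrix_rows[of "Y ** W"] norm_matrix_rows[of Y] sum_distrib_left
    by (intro sum_mono) (metis power_mono norm_ge_zero power_mult_distrib)
qed (simp add: max_singular_value_nonneg)

section \<open>Operator norm on a subspace\<close>

lemma onorm_on_bound:
  fixes f :: "'a::real_normed_vector \<Rightarrow> 'b::real_normed_vector"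
  assumes "bounded_linear f" "x \<in> S"
  shows "norm (f x) \<le> onorm_on S f * norm x"
proof (cases "x = 0")
  case True
  then show ?thesis using assms by (simp add: linear_simps)
next
  case False
  \<comment> \<open>The unrestricted operator norm bounds all quotients, so the supremum in
    \<open>onorm_on\<close> is taken over a bounded set.\<close>
  have "norm (f y) / norm y \<le> onorm f" for y
    by (rule le_onorm[OF assms(1)])
  then have "bdd_above ((\<lambda>x. norm (f x) / norm x) ` S)"
    by (intro bdd_aboveI) auto
  then have "norm (f x) / norm x \<le> onorm_on S f"
    unfolding onorm_on_def using assms(2) by (rule cSUP_upper[rotated])
  with False show ?thesis by (simp add: divide_le_eq)
qed

lemma onorm_on_nonneg:
  assumes "bounded_linear f" "0 \<in> S"
  shows "0 \<le> onorm_on S f"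
proof -
  have "bdd_above ((\<lambda>x. norm (f x) / norm x) ` S)"
    using le_onorm[OF assms(1)] by (intro bdd_aboveI) auto
  \<comment> \<open>The quotient at \<open>0\<close> is \<open>0 / 0 = 0\<close>, so the supremum is
    at least \<open>0\<close> even on the trivial subspace.\<close>
  from cSUP_upper[OF assms(2) this] show ?thesis by (simp add: onorm_on_def)
qed

section \<open>Orthogonal projection onto the complement of \<open>U\<close>\<close>

text \<open>Each \<open>tensor (e m) (e m)\<close> is the rank-one projection onto the line of
  \<open>e m\<close>. Being a matrix, the projection acts on \<open>X\<close> from the left and
  passes a right factor \<open>W\<close> by associativity.\<close>

definition perp_matrix :: "nat \<Rightarrow> (nat \<Rightarrow> real ^ 'n) \<Rightarrow> real ^ 'n ^ 'n" where
  "perp_matrix M e = mat 1 - (\<Sum>m=1..M. tensor (e m) (e m))"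

lemma tensor_mult_vec: "tensor u v *v x = (v \<bullet> x) *\<^sub>R u"
  by (simp add: vec_eq_iff tensor_def matrix_vector_mult_def inner_vec_def sum_distrib_left mult_ac)

lemma sum_matrix_vector_mult: "(\<Sum>m\<in>I. f m) *v x = (\<Sum>m\<in>I. f m *v x)"
  for f :: "_ \<Rightarrow> real ^ 'n ^ 'm"
  by (induction I rule: infinite_finite_induct) (simp_all add: matrix_vector_mult_add_rdistrib)

lemma perp_matrix_mult: "perp_matrix M e *v x = x - (\<Sum>m=1..M. (e m \<bullet> x) *\<^sub>R e m)"
  by (simp add: perp_matrix_def matrix_vector_mult_diff_rdistrib sum_matrix_vector_mult tensor_mult_vec)

context
  fixes M :: nat and e :: "nat \<Rightarrow> real ^ 'n" and U :: "(real ^ 'n) set"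
  assumes basis: "orthonormal_basis M e U"
begin

lemma basis_inner: "i \<in> {1..M} \<Longrightarrow> j \<in> {1..M} \<Longrightarrow> e i \<bullet> e j = (if i = j then 1 else 0)"
  using basis by (simp add: orthonormal_basis_def)

lemma basis_span: "U = span (e ` {1..M})"
  using basis by (simp add: orthonormal_basis_def)

lemma basis_inner_perp:
  assumes "i \<in> {1..M}"
  shows "e i \<bullet> (perp_matrix M e *v x) = 0"
proof -
  have "(\<Sum>m=1..M. (e m \<bullet> x) * (e i \<bullet> e m)) = (\<Sum>m=1..M. if m = i then e i \<bullet> x else 0)"
    using assms by (intro sum.cong) (auto simp: basis_inner)
  with assms show ?thesis
    by (simp add: perp_matrix_mult inner_diff_right inner_sum_right)
qed

text \<open>Pythagoras: the projected vector is orthogonal to every \<open>e m\<close>, so its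
  squared norm is its inner product with \<open>x\<close>.\<close>

lemma norm_perp: "(norm (perp_matrix M e *v x))\<^sup>2 = (norm x)\<^sup>2 - (\<Sum>m=1..M. (e m \<bullet> x)\<^sup>2)"
proof -
  let ?y = "perp_matrix M e *v x"
  have "(norm ?y)\<^sup>2 = x \<bullet> ?y - (\<Sum>m=1..M. (e m \<bullet> x) * (e m \<bullet> ?y))"
    unfolding power2_norm_eq_inner
    by (subst (1) perp_matrix_mult) (simp add: inner_diff_left inner_sum_left)
  also have "\<dots> = x \<bullet> ?y" by (simp add: basis_inner_perp)
  also have "\<dots> = (norm x)\<^sup>2 - (\<Sum>m=1..M. (e m \<bullet> x)\<^sup>2)"
    unfolding power2_norm_eq_inner
    by (simp add: perp_matrix_mult inner_diff_right inner_sum_right power2_eq_square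
        inner_commute[of x "e _"])
  finally show ?thesis .
qed

lemma bessel: "(\<Sum>m=1..M. (e m \<bullet> x)\<^sup>2) \<le> (norm x)\<^sup>2"
  using norm_perp[of x] by (metis diff_ge_0_iff_ge zero_le_power2)

lemma norm_perp_le: "norm (perp_matrix M e *v x) \<le> norm x"
  by (rule power2_le_imp_le) (simp_all add: norm_perp sum_nonneg)

lemma perp_basis: "i \<in> {1..M} \<Longrightarrow> perp_matrix M e *v e i = 0"
proof -
  assume i: "i \<in> {1..M}"
  have "(\<Sum>m=1..M. (e m \<bullet> e i) *\<^sub>R e m) = (\<Sum>m=1..M. if m = i then e i else 0)"
    using i by (intro sum.cong) (auto simp: basis_inner)
  with i show ?thesis by (simp add: perp_matrix_mult)
qed

lemma perp_eq_0: "u \<in> U \<Longrightarrow> perp_matrix M e *v u = 0"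
  unfolding basis_span
  by (rule linear_eq_0_on_span[where b = "e ` {1..M}"]) (auto intro: perp_basis)

lemma diff_perp_in: "x - perp_matrix M e *v x \<in> U"
  unfolding perp_matrix_mult basis_span
  by simp (intro span_sum span_scale span_base, simp)

lemma orthogonal_comp_iff: "y \<in> orthogonal_comp U \<longleftrightarrow> (\<forall>m\<in>{1..M}. e m \<bullet> y = 0)"
proof
  assume "y \<in> orthogonal_comp U"
  then show "\<forall>m\<in>{1..M}. e m \<bullet> y = 0"
    by (auto simp: orthogonal_comp_def orthogonal_def basis_span intro: span_base)
next
  assume *: "\<forall>m\<in>{1..M}. e m \<bullet> y = 0"
  have "orthogonal u y" if "u \<in> span (e ` {1..M})" for u
    unfolding orthogonal_commute[of u]
    by (rule orthogonal_to_span[OF that]) (use * in \<open>auto simp: orthogonal_def inner_commute[of y]\<close>)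
  then show "y \<in> orthogonal_comp U"
    by (simp add: orthogonal_comp_def basis_span)
qed

lemma perp_in: "perp_matrix M e *v x \<in> orthogonal_comp U"
  by (simp add: orthogonal_comp_iff basis_inner_perp)

lemma perp_eq_self: "y \<in> orthogonal_comp U \<Longrightarrow> perp_matrix M e *v y = y"
  by (simp add: orthogonal_comp_iff perp_matrix_mult)

section \<open>Distance to the tensor space under linear maps\<close>

text \<open>Subtracting the projection from \<open>X\<close> gives a point of the space at the
  claimed distance. Conversely, the projection kills every \<open>Y\<close> in the space and does
  not increase norms, so no \<open>Y\<close> is nearer.\<close>

lemma infdist_tensor_space:
  fixes X :: "real ^ 'c ^ 'n"
  shows "infdist X (tensor_space M e) = norm (perp_matrix M e ** X)"
proof (rule antisym)
  have "X - perp_matrix M e ** X = (\<Sum>m=1..M. tensor (e m) (\<chi> c. e m \<bullet> column c X))"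
  proof -
    have "column c (X - perp_matrix M e ** X) =
        column c (\<Sum>m=1..M. tensor (e m) (\<chi> c. e m \<bullet> column c X))" for c
    proof -
      have "column c (X - perp_matrix M e ** X) = column c X - perp_matrix M e *v column c X"
        by (simp add: column_matrix_mult[symmetric]) (simp add: column_def vec_eq_iff)
      then show ?thesis
        by (simp add: perp_matrix_mult column_def vec_eq_iff tensor_def mult_ac)
    qed
    then show ?thesis by (simp add: column_def vec_eq_iff)
  qed
  then have "X - perp_matrix M e ** X \<in> tensor_space M e"
    unfolding tensor_space_def by (intro CollectI exI conjI TrueI)
  from infdist_le[OF this, of X] show "infdist X (tensor_space M e) \<le> norm (perp_matrix M e ** X)"
    by (simp add: dist_norm)
next
  have "norm (perp_matrix M e ** X) \<le> dist X Y" if Y: "Y \<in> tensor_space M e" for Y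
  proof -
    obtain w where w: "Y = (\<Sum>m=1..M. tensor (e m) (w m))"
      using Y by (auto simp: tensor_space_def)
    have "column c Y = (\<Sum>m=1..M. (w m $ c) *\<^sub>R e m)" for c
      by (simp add: w column_def vec_eq_iff tensor_def mult.commute)
    then have "column c Y \<in> U" for c
      unfolding basis_span by simp (intro span_sum span_scale span_base, simp)
    then have "perp_matrix M e *v column c Y = 0" for c
      by (simp add: perp_eq_0)
    then have "perp_matrix M e *v column c X = perp_matrix M e *v column c (X - Y)" for c
    proof -
      have "column c (X - Y) = column c X - column c Y" by (simp add: column_def vec_eq_iff)
      with \<open>perp_matrix M e *v column c Y = 0\<close> show ?thesis
        by (simp add: matrix_vector_mult_diff_distrib)
    qed
    then have "norm (perp_matrix M e ** X) \<le> 1 * norm (X - Y)"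
      by (intro norm_le_by_columns) (simp_all add: column_matrix_mult norm_perp_le)
    then show ?thesis by (simp add: dist_norm)
  qed
  \<comment> \<open>\<open>infdist\<close> to the empty set is \<open>0\<close> by convention; only
    for a non-empty set is it the infimum.\<close>
  moreover have "tensor_space M e \<noteq> ({} :: (real ^ 'c ^ 'n) set)"
    by (auto simp: tensor_space_def)
  ultimately show "norm (perp_matrix M e ** X) \<le> infdist X (tensor_space M e)"
    by (simp add: infdist_notempty cINF_greatest)
qed

lemma infdist_mult_right:
  fixes X :: "real ^ 'c ^ 'n" and W :: "real ^ 'd ^ 'c"
  shows "infdist (X ** W) (tensor_space M e) \<le> max_singular_value W * infdist X (tensor_space M e)"
  by (simp add: infdist_tensor_space matrix_mul_assoc norm_mult_right_max_singular_value)

lemma infdist_mult_left: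
  fixes X :: "real ^ 'c ^ 'n"
  assumes sym: "transpose P = P" and inv: "\<forall>u\<in>U. P *v u \<in> U"
  shows "infdist (P ** X) (tensor_space M e)
    \<le> onorm_on (orthogonal_comp U) (\<lambda>x. P *v x) * infdist X (tensor_space M e)"
proof -
  let ?A = "perp_matrix M e"
  \<comment> \<open>Symmetry moves \<open>P\<close> onto the vector of \<open>U\<close>, which stays
    in \<open>U\<close>.\<close>
  have inv_perp: "P *v y \<in> orthogonal_comp U" if "y \<in> orthogonal_comp U" for y
    using that inv by (auto simp: orthogonal_comp_def orthogonal_def symmetric_matrix_inner[OF sym])
  have commute: "?A *v (P *v x) = P *v (?A *v x)" for x
  proof -
    \<comment> \<open>Split \<open>x\<close> into its parts in \<open>U\<close> and in the
      complement; \<open>P\<close> preserves both, and \<open>?A\<close> kills the first and fixes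
      the second.\<close>
    have "?A *v (P *v x) = ?A *v (P *v (x - ?A *v x)) + ?A *v (P *v (?A *v x))"
      by (simp add: matrix_vector_mult_diff_distrib)
    also have "\<dots> = P *v (?A *v x)"
      using inv diff_perp_in inv_perp perp_in by (simp add: perp_eq_0 perp_eq_self)
    finally show ?thesis .
  qed
  have "norm (?A ** (P ** X)) \<le> onorm_on (orthogonal_comp U) (\<lambda>x. P *v x) * norm (?A ** X)"
  proof (rule norm_le_by_columns)
    show "norm (column c (?A ** (P ** X)))
        \<le> onorm_on (orthogonal_comp U) (\<lambda>x. P *v x) * norm (column c (?A ** X))" for c
      by (simp add: column_matrix_mult commute onorm_on_bound perp_in)
    show "0 \<le> onorm_on (orthogonal_comp U) (\<lambda>x. P *v x)"
      by (rule onorm_on_nonneg) (simp_all add: orthogonal_comp_iff)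
  qed
  then show ?thesis by (simp add: infdist_tensor_space)
qed

section \<open>ReLU and the full layer\<close>

lemma norm_perp_pos_part_le:
  assumes nonneg: "\<forall>m\<in>{1..M}. \<forall>n. e m $ n \<ge> 0"
  shows "norm (perp_matrix M e *v (\<chi> n. max (x $ n) 0)) \<le> norm (perp_matrix M e *v x)"
proof (rule power2_le_imp_le)
  define p where "p = (\<chi> n. max (x $ n) 0)"
  define q where "q = (\<chi> n. max (- x $ n) 0)"
  have x: "x = p - q" by (simp add: p_def q_def vec_eq_iff max_def)
  \<comment> \<open>The positive and negative parts have disjoint supports.\<close>
  have "p \<bullet> q = 0"
    unfolding inner_vec_def by (rule sum.neutral) (auto simp: p_def q_def max_def)
  then have norm_x: "(norm x)\<^sup>2 = (norm p)\<^sup>2 + (norm q)\<^sup>2"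
    by (simp add: x power2_norm_eq_inner inner_diff inner_commute[of q p])
  have "(e m \<bullet> x)\<^sup>2 \<le> (e m \<bullet> p)\<^sup>2 + (e m \<bullet> q)\<^sup>2" if "m \<in> {1..M}" for m
  proof -
    have "0 \<le> e m \<bullet> p" "0 \<le> e m \<bullet> q"
      using nonneg that by (auto simp: inner_vec_def p_def q_def intro!: sum_nonneg)
    \<comment> \<open>This is the cross term, which enters the square of
      \<open>e m \<bullet> (p - q)\<close> with a minus sign and may be dropped. Non-negativity of
      the basis enters here.\<close>
    then have "0 \<le> (e m \<bullet> p) * (e m \<bullet> q)" by simp
    then show ?thesis by (simp add: x inner_diff_right power2_diff)
  qed
  then have "(\<Sum>m=1..M. (e m \<bullet> x)\<^sup>2) \<le> (\<Sum>m=1..M. (e m \<bullet> p)\<^sup>2 + (e m \<bullet> q)\<^sup>2)"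
    by (intro sum_mono)
  also have "\<dots> \<le> (\<Sum>m=1..M. (e m \<bullet> p)\<^sup>2) + (norm q)\<^sup>2"
    by (simp add: sum.distrib bessel[simplified])
  finally show "(norm (perp_matrix M e *v (\<chi> n. max (x $ n) 0)))\<^sup>2 \<le> (norm (perp_matrix M e *v x))\<^sup>2"
    unfolding norm_perp p_def[symmetric] norm_x by simp
qed simp

lemma infdist_relu:
  fixes X :: "real ^ 'c ^ 'n"
  assumes "\<forall>m\<in>{1..M}. \<forall>n. e m $ n \<ge> 0"
  shows "infdist (relu X) (tensor_space M e) \<le> infdist X (tensor_space M e)"
proof -
  have "column c (relu X) = (\<chi> n. max (column c X $ n) 0)" for c
    by (simp add: relu_def column_def)
  then have "norm (perp_matrix M e ** relu X) \<le> 1 * norm (perp_matrix M e ** X)"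
    by (intro norm_le_by_columns) (simp_all add: column_matrix_mult norm_perp_pos_part_le[OF assms])
  then show ?thesis by (simp add: infdist_tensor_space)
qed

text \<open>Each activation costs nothing, so every weight contributes just its singular value; the
  activation of the input matches the empty product.\<close>

lemma infdist_mlp:
  fixes X :: "real ^ 'c ^ 'n"
  assumes nonneg: "\<forall>m\<in>{1..M}. \<forall>n. e m $ n \<ge> 0"
  shows "infdist (mlp W h X) (tensor_space M e)
    \<le> (\<Prod>i=1..h. max_singular_value (W i)) * infdist X (tensor_space M e)"
proof (induction h)
  case 0
  then show ?case using infdist_relu[OF nonneg] by simp
next
  case (Suc h)
  have "infdist (mlp W (Suc h) X) (tensor_space M e)
      \<le> infdist (mlp W h X ** W (Suc h)) (tensor_space M e)"
    using infdist_relu[OF nonneg] by simp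
  also have "\<dots> \<le> max_singular_value (W (Suc h)) * infdist (mlp W h X) (tensor_space M e)"
    by (rule infdist_mult_right)
  also have "\<dots> \<le> max_singular_value (W (Suc h)) *
      ((\<Prod>i=1..h. max_singular_value (W i)) * infdist X (tensor_space M e))"
    by (intro mult_left_mono Suc.IH max_singular_value_nonneg)
  finally show ?case by (simp add: mult_ac)
qed

end

theorem theorem1:
  fixes P :: "real ^ 'n ^ 'n"
    and U :: "(real ^ 'n) set"
    and M :: nat
    and e :: "nat \<Rightarrow> real ^ 'n"
    and H :: "nat \<Rightarrow> nat"
    and W :: "nat \<Rightarrow> nat \<Rightarrow> real ^ 'c ^ 'c"
  assumes "transpose P = P"
    and "subspace U" and "dim U = M" and "M \<le> CARD('n)"
    and "orthonormal_basis M e U"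
    and "\<forall>m\<in>{1..M}. \<forall>n. e m $ n \<ge> 0"
    and "\<forall>u\<in>U. P *v u \<in> U"
    and "\<forall>l\<ge>1. H l \<ge> 1"
  shows "\<forall>l\<ge>1. \<forall>X :: real ^ 'c ^ 'n.
    infdist (gnn_layer P (W l) (H l) X) (tensor_space M e)
      \<le> (\<Prod>h=1..H l. max_singular_value (W l h))
          * onorm_on (orthogonal_comp U) (\<lambda>x. P *v x)
          * infdist X (tensor_space M e)"
proof (intro allI impI)
  fix l :: nat and X :: "real ^ 'c ^ 'n"
  let ?T = "tensor_space M e :: (real ^ 'c ^ 'n) set"
  let ?s = "\<Prod>h=1..H l. max_singular_value (W l h)"
  have "infdist (gnn_layer P (W l) (H l) X) ?T \<le> ?s * infdist (P ** X) ?T"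
    unfolding gnn_layer_def by (rule infdist_mlp[OF assms(5,6)])
  also have "\<dots> \<le> ?s * (onorm_on (orthogonal_comp U) (\<lambda>x. P *v x) * infdist X ?T)"
    \<comment> \<open>The bound for \<open>P\<close> may be multiplied by the weight product because
      singular value bounds are non-negative.\<close>
    by (intro mult_left_mono infdist_mult_left[OF assms(5,1,7)] prod_nonneg)
      (simp add: max_singular_value_nonneg)
  finally show "infdist (gnn_layer P (W l) (H l) X) ?T
      \<le> ?s * onorm_on (orthogonal_comp U) (\<lambda>x. P *v x) * infdist X ?T"
    by (simp add: mult.assoc)
qed

end
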